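(* Let $a,b,m$ be positive integers, let $1\le l\le m$ and $0\le k\le m-l$ be integers. The number of parking functions $(\pi_1,\dots,\pi_m)\in\mathrm{PF}(a,b,m)$ with $\pi_1=a+kb,\ \pi_2=a+(k+1)b,\ \dots,\ \pi_l=a+(k+l-1)b$ is $$a\sum_{s=0}^{m-l-k}\binom{m-l}{s}\,(a+(m-l-s)b)^{m-s-l-1}\,b^s\,l\,(s+l)^{s-1}.$$
   Context: $\mathrm{PF}(a,b,m)$ is the set of $(a,b)$-parking functions of length $m$: sequences $(\pi_1,\dots,\pi_m)$ of positive integers whose non-decreasing rearrangement $(\lambda_1,\dots,\lambda_m)$ satisfies $\lambda_i\le a+(i-1)b$ for all $1\le i\le m$. *)

theory Defs
  imports Complex_Main
begin

text \<open>
  Sequences are lists and lists are indexed from 0, so the bound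
  \<open>\<lambda>\<^sub>i \<le> a + (i - 1) b\<close> for \<open>1 \<le> i \<le> m\<close> becomes \<open>a + i * b\<close> for \<open>i < m\<close>.
\<close>

definition PF :: "nat \<Rightarrow> nat \<Rightarrow> nat \<Rightarrow> nat list set" where
  "PF a b m =
     {\<pi>. length \<pi> = m \<and> (\<forall>x\<in>set \<pi>. 0 < x) \<and> (\<forall>i<m. sort \<pi> ! i \<le> a + i * b)}"

end

theory Submission imports Defs begin

text \<open>
  A list with \<open>m\<close> positive entries is an \<open>(a, b)\<close>-parking function iff, for every \<open>i < m\<close>, more
  than \<open>i\<close> of its entries are at most \<open>a + i b\<close>. The prescribed entries
  \<open>a + k b, \<dots>, a + (k + l - 1) b\<close> contribute a known amount to each of these counts, so, with
  \<open>n = m - l\<close>, the remaining \<open>n\<close> entries have to satisfy a condition of the same kind, in which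
  the bounds run along \<open>a, a + b, \<dots>, a + (k - 1) b\<close>, then jump by \<open>l b\<close>, and run on along
  \<open>a + (k + l) b, \<dots>, a + (n + l - 1) b\<close> (\<open>append_progression_PF_iff\<close>).

  Let \<open>t\<close> be the first index at which such a list violates the bounds of an ordinary parking
  function, that is, at which at most \<open>t\<close> entries are \<open>\<le> a + t b\<close>; if it violates none of the \<open>n\<close>
  bounds, then \<open>t = n\<close>. Then exactly \<open>t\<close> entries are
  \<open>\<le> a + t b\<close>, they form a member of \<open>PF a b t\<close>, and the other \<open>s = n - t\<close> entries, lowered by
  \<open>a + t b\<close>, form a member of \<open>PF (l b) b s\<close>. Conversely, any two such lists can be interleaved
  arbitrarily as soon as \<open>t \<ge> k\<close>. Hence the number sought is (\<open>card_gap_PF\<close>)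
  \<open>\<Sum>s = 0..n - k. (n choose s) * |PF(a, b, n - s)| * |PF(l b, b, s)|\<close>,
  and the formula follows from \<open>|PF(a, b, n)| = a (a + n b) ^ (n - 1)\<close> (\<open>card_PF\<close>): with
  \<open>l b\<close> and \<open>s\<close> in place of \<open>a\<close> and \<open>n\<close> the right-hand side is \<open>b ^ s l (s + l) ^ (s - 1)\<close>.

  The closed form for \<open>|PF(a, b, n)|\<close> is obtained by induction: removing the ones from a member
  of \<open>PF (a + 1) b n\<close> and lowering the other entries by one leaves a member of
  \<open>PF (a + j b) b (n - j)\<close>, where \<open>j\<close> is the number of ones. All the terms of the resulting
  recurrence involve powers of the same number \<open>a + j b + (n - j) b = a + n b\<close>, so the binomial
  theorem evaluates it.
\<close>

section \<open>Splitting a list at a threshold\<close>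

definition num_le :: "nat list \<Rightarrow> nat \<Rightarrow> nat" where
  "num_le xs c = length (filter (\<lambda>x. x \<le> c) xs)"

definition low :: "nat \<Rightarrow> nat list \<Rightarrow> nat list" where
  "low c xs = filter (\<lambda>x. x \<le> c) xs"

definition high :: "nat \<Rightarrow> nat list \<Rightarrow> nat list" where
  "high c xs = map (\<lambda>x. x - c) (filter (\<lambda>x. \<not> x \<le> c) xs)"

lemma num_le_append: "num_le (xs @ ys) c = num_le xs c + num_le ys c"
  by (simp add: num_le_def)

lemma num_le_mono: "c \<le> d \<Longrightarrow> num_le xs c \<le> num_le xs d"
  by (induction xs) (auto simp: num_le_def)

lemma num_le_le_length: "num_le xs c \<le> length xs"
  by (simp add: num_le_def)

lemma num_le_zero: "\<forall>x\<in>set xs. 0 < x \<Longrightarrow> num_le xs 0 = 0"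
  by (simp add: num_le_def)

lemma length_low: "length (low c xs) = num_le xs c"
  by (simp add: low_def num_le_def)

lemma num_le_low: "d \<le> c \<Longrightarrow> num_le (low c xs) d = num_le xs d"
  by (induction xs) (auto simp: low_def num_le_def)

lemma num_le_high: "num_le xs c + num_le (high c xs) d = num_le xs (c + d)"
  by (induction xs) (auto simp: high_def num_le_def)

lemma length_low_high: "length (low c xs) + length (high c xs) = length xs"
  by (induction xs) (auto simp: low_def high_def)

lemma positive_low_high:
  "(\<forall>x\<in>set (low c xs). 0 < x) \<longleftrightarrow> (\<forall>x\<in>set xs. 0 < x)"
  "\<forall>x\<in>set (high c xs). 0 < x"
  by (auto simp: low_def high_def)

text \<open>
  A list is determined by its entries up to \<open>c\<close>, its entries above \<open>c\<close>, and the way the two are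
  interleaved. The lists with given \<open>low\<close> and \<open>high\<close> parts are thus the shuffles of two lists without
  a common entry, whose number is a binomial coefficient. Both decompositions of the proof, at the
  ones and at the first violated bound, are counted by this lemma.
\<close>

lemma card_low_high:
  assumes "finite A" "finite B"
    and A: "\<And>xs. xs \<in> A \<Longrightarrow> length xs = t \<and> (\<forall>x\<in>set xs. x \<le> c)"
    and B: "\<And>xs. xs \<in> B \<Longrightarrow> length xs = s \<and> (\<forall>x\<in>set xs. 0 < x)"
  shows "finite {xs. low c xs \<in> A \<and> high c xs \<in> B}"
    and "card {xs. low c xs \<in> A \<and> high c xs \<in> B} = ((t + s) choose s) * card A * card B"
proof -
  define up where "up = map (\<lambda>x::nat. x + c)"
  define fib where "fib = (\<lambda>(ys, zs). shuffles ys (up zs))"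
  have fib: "xs \<in> fib (ys, zs) \<longleftrightarrow> low c xs = ys \<and> high c xs = zs"
    if "ys \<in> A" "zs \<in> B" for xs ys zs
  proof -
    have "partition (\<lambda>x. x \<le> c) -` {(ys, up zs)} = shuffles ys (up zs)"
      using A[OF that(1)] B[OF that(2)]
      by (intro inv_image_partition) (auto simp: up_def)
    then have "xs \<in> fib (ys, zs) \<longleftrightarrow> low c xs = ys \<and> filter (\<lambda>x. \<not> x \<le> c) xs = up zs"
      by (auto simp: fib_def low_def o_def)
    moreover have "filter (\<lambda>x. \<not> x \<le> c) xs = up zs \<longleftrightarrow> high c xs = zs"
      (is "?f = _ \<longleftrightarrow> _")
    proof -
      have "up (high c xs) = ?f"
        by (auto simp: up_def high_def o_def intro!: map_idI)
      moreover have "map (\<lambda>x. x - c) (up zs) = zs"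
        by (simp add: up_def o_def)
      ultimately show ?thesis
        by (auto simp: high_def)
    qed
    ultimately show ?thesis by simp
  qed
  have eq: "{xs. low c xs \<in> A \<and> high c xs \<in> B} = (\<Union>p\<in>A \<times> B. fib p)"
    using fib by auto
  have fin: "finite (fib p)" for p
    by (cases p) (simp add: fib_def)
  show "finite {xs. low c xs \<in> A \<and> high c xs \<in> B}"
    unfolding eq using assms(1,2) fin by blast
  have "card (fib p) = (t + s) choose s" if "p \<in> A \<times> B" for p
  proof -
    from that obtain ys zs where p: "p = (ys, zs)" "ys \<in> A" "zs \<in> B"
      by auto
    have "set ys \<inter> set (up zs) = {}"
      using A[OF p(2)] B[OF p(3)] by (fastforce simp: up_def)
    then have "card (fib p) = (t + s) choose t"
      using A[OF p(2)] B[OF p(3)] p(1)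
      by (simp add: fib_def card_disjoint_shuffles up_def)
    then show ?thesis using binomial_symmetric[of t "t + s"] by simp
  qed
  moreover have "card (\<Union>p\<in>A \<times> B. fib p) = (\<Sum>p\<in>A \<times> B. card (fib p))"
    using assms(1,2) fin fib
    by (intro card_UN_disjoint) (simp_all, fastforce)
  ultimately show "card {xs. low c xs \<in> A \<and> high c xs \<in> B} = ((t + s) choose s) * card A * card B"
    unfolding eq by (simp add: card_cartesian_product)
qed

section \<open>Parking functions by counting entries\<close>

lemma sorted_nth_le_iff:
  "sorted xs \<Longrightarrow> i < length xs \<Longrightarrow> xs ! i \<le> c \<longleftrightarrow> i < num_le xs c"
proof (induction xs arbitrary: i)
  case (Cons x xs)
  show ?case
  proof (cases "x \<le> c")
    case True
    then show ?thesis using Cons by (cases i) (auto simp: num_le_def)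
  next
    case False
    then have "\<forall>y\<in>set (x # xs). \<not> y \<le> c"
      using Cons.prems(1) by auto
    then have "num_le (x # xs) c = 0" "\<not> (x # xs) ! i \<le> c"
      using nth_mem[OF Cons.prems(2)] by (auto simp: num_le_def)
    then show ?thesis by simp
  qed
qed simp

lemma num_le_sort: "num_le (sort xs) c = num_le xs c"
  by (simp add: num_le_def filter_sort)

text \<open>
  Counts of entries, unlike the sorted list, behave well under appending and splitting, so this
  description replaces the definition from here on.
\<close>

lemma PF_iff:
  "xs \<in> PF a b n \<longleftrightarrow>
     length xs = n \<and> (\<forall>x\<in>set xs. 0 < x) \<and> (\<forall>i<n. i < num_le xs (a + i * b))"
  unfolding PF_def using sorted_nth_le_iff[of "sort xs"] by (auto simp: num_le_sort)

lemma PF_le: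
  assumes "xs \<in> PF a b n" "x \<in> set xs"
  shows "x \<le> a + n * b"
proof -
  have n: "n = length xs" "0 < n"
    using assms by (auto simp: PF_iff)
  then have "n - 1 < num_le xs (a + (n - 1) * b)"
    using assms by (auto simp: PF_iff)
  also have "\<dots> \<le> num_le xs (a + n * b)"
    by (rule num_le_mono) simp
  finally have "num_le xs (a + n * b) = length xs"
    using n num_le_le_length[of xs "a + n * b"] by linarith
  then show ?thesis
    using length_filter_less[OF assms(2), of "\<lambda>x. x \<le> a + n * b"]
    unfolding num_le_def by linarith
qed

lemma finite_PF: "finite (PF a b n)"
proof (rule finite_subset)
  show "PF a b n \<subseteq> {xs. set xs \<subseteq> {..a + n * b} \<and> length xs = n}"
    using PF_le by (fastforce simp: PF_iff)
qed (simp add: finite_lists_length_eq)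

lemma PF_length_pos: "xs \<in> PF a b n \<Longrightarrow> length xs = n \<and> (\<forall>x\<in>set xs. 0 < x)"
  by (simp add: PF_iff)

lemma PF_0: "PF a b 0 = {[]}"
  by (auto simp: PF_iff)

lemma PF_zero_start: "0 < n \<Longrightarrow> PF 0 b n = {}"
  using num_le_zero by (fastforce simp: PF_iff)

section \<open>The number of parking functions\<close>

text \<open>
  With \<open>j\<close> ones, the \<open>i\<close>-th bound is trivial for \<open>i < j\<close>, and for \<open>i \<ge> j\<close> it is the \<open>(i - j)\<close>-th bound
  on the lowered list of the other entries, with first bound \<open>a + j b\<close>.
\<close>

lemma PF_Suc_iff:
  assumes "j \<le> n"
  shows "xs \<in> PF (Suc a) b n \<and> num_le xs 1 = j \<longleftrightarrow>
    low 1 xs \<in> {replicate j 1} \<and> high 1 xs \<in> PF (a + j * b) b (n - j)"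
proof -
  have ones: "low 1 xs = replicate j 1 \<longleftrightarrow> num_le xs 1 = j \<and> (\<forall>x\<in>set xs. 0 < x)"
  proof
    assume *: "low 1 xs = replicate j 1"
    show "num_le xs 1 = j \<and> (\<forall>x\<in>set xs. 0 < x)"
      using length_low[of 1 xs] positive_low_high(1)[of 1 xs] unfolding * by simp
  next
    assume *: "num_le xs 1 = j \<and> (\<forall>x\<in>set xs. 0 < x)"
    then have "\<forall>x\<in>set (low 1 xs). x = 1" "length (low 1 xs) = j"
      by (auto simp: length_low) (auto simp: low_def)
    then show "low 1 xs = replicate j 1"
      by (metis replicate_eqI)
  qed
  have "(\<forall>i<n. i < num_le xs (Suc a + i * b)) \<longleftrightarrow>
      (\<forall>i<n - j. i < num_le (high 1 xs) (a + j * b + i * b))"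
    if j: "num_le xs 1 = j"
  proof -
    have shift: "num_le xs (Suc a + i * b) = j + num_le (high 1 xs) (a + i * b)" for i
      using num_le_high[of xs 1 "a + i * b"] j by simp
    have *: "i < j + num_le (high 1 xs) (a + i * b)"
      if "\<forall>i<n - j. i < num_le (high 1 xs) (a + j * b + i * b)" "i < n" for i
    proof (cases "i < j")
      case False
      then have "i - j < num_le (high 1 xs) (a + j * b + (i - j) * b)"
        using that by simp
      also have "a + j * b + (i - j) * b = a + i * b"
        using False by (simp add: add_mult_distrib[symmetric])
      finally show ?thesis using False by simp
    qed simp
    have **: "i < num_le (high 1 xs) (a + j * b + i * b)"
      if "\<forall>i<n. i < j + num_le (high 1 xs) (a + i * b)" "i < n - j" for i
      using that(1)[rule_format, of "i + j"] that(2) by (simp add: algebra_simps)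
    show ?thesis
      unfolding shift using * ** by blast
  qed
  moreover have "length xs = n \<longleftrightarrow> length (high 1 xs) = n - j" if "num_le xs 1 = j"
    using length_low_high[of 1 xs] that assms by (auto simp: length_low)
  ultimately show ?thesis
    using ones positive_low_high(2)[of 1 xs] by (auto simp: PF_iff)
qed

lemma card_PF_Suc:
  "card (PF (Suc a) b n) = (\<Sum>j\<le>n. (n choose j) * card (PF (a + j * b) b (n - j)))"
proof -
  let ?F = "\<lambda>j. {xs. low 1 xs \<in> {replicate j 1} \<and> high 1 xs \<in> PF (a + j * b) b (n - j)}"
  have F: "?F j = {xs \<in> PF (Suc a) b n. num_le xs 1 = j}" if "j \<le> n" for j
    using PF_Suc_iff[OF that] by blast
  have "card (?F j) = (n choose j) * card (PF (a + j * b) b (n - j))" if "j \<le> n" for j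
  proof -
    have "card (?F j) = ((j + (n - j)) choose (n - j)) * card {replicate j (1::nat)}
        * card (PF (a + j * b) b (n - j))"
      by (rule card_low_high(2)) (auto simp: finite_PF PF_length_pos)
    then show ?thesis
      using that by (simp add: binomial_symmetric[OF that])
  qed
  then have "(\<Sum>j\<le>n. (n choose j) * card (PF (a + j * b) b (n - j))) = (\<Sum>j\<le>n. card (?F j))"
    by simp
  also have "\<dots> = (\<Sum>j\<le>n. card {xs \<in> PF (Suc a) b n. num_le xs 1 = j})"
    by (intro sum.cong refl arg_cong[where f = card] F) simp
  also have "\<dots> = card (\<Union>j\<le>n. {xs \<in> PF (Suc a) b n. num_le xs 1 = j})"
    by (rule card_UN_disjoint[symmetric]) (auto simp: finite_PF)
  also have "(\<Union>j\<le>n. {xs \<in> PF (Suc a) b n. num_le xs 1 = j}) = PF (Suc a) b n"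
    using num_le_le_length by (fastforce simp: PF_iff)
  finally show ?thesis by simp
qed

lemma sum_binomial_pow: "(\<Sum>j\<le>n. (n choose j) * x ^ (n - j)) = (x + 1 :: nat) ^ n"
  using binomial_ring[of 1 x n] unfolding add.commute[of 1 x] by simp

lemma sum_index_binomial_pow:
  "(\<Sum>j\<le>n. j * (n choose j) * x ^ (n - j)) = n * (x + 1 :: nat) ^ (n - 1)"
proof (cases n)
  case (Suc p)
  have "(\<Sum>j\<le>n. j * (n choose j) * x ^ (n - j))
      = (\<Sum>j\<le>p. Suc j * (n choose Suc j) * x ^ (n - Suc j))"
    unfolding Suc by (subst sum.atMost_Suc_shift) simp
  also have "\<dots> = (\<Sum>j\<le>p. n * ((p choose j) * x ^ (p - j)))"
    unfolding Suc by (intro sum.cong refl) (simp only: binomial_absorption mult.assoc diff_Suc_Suc diff_Suc_1)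
  finally show ?thesis
    unfolding sum_distrib_left[symmetric] sum_binomial_pow by (simp add: Suc)
qed simp

text \<open>
  The claim \<open>|PF(a, b, n)| = a (a + n b) ^ (n - 1)\<close>, multiplied by \<open>a + n b\<close>: in this form it also
  holds for \<open>n = 0\<close>, and it stays within the natural numbers. The recurrence leads from
  \<open>(a + 1, n)\<close> to \<open>(a, n)\<close> and to pairs with smaller \<open>n\<close>, whence the nested induction.
\<close>

lemma card_PF_mult:
  assumes "0 < b"
  shows "(a + n * b) * card (PF a b n) = a * (a + n * b) ^ n"
proof (induction n arbitrary: a rule: less_induct)
  case (less n)
  show ?case
  proof (cases "n = 0")
    case False
    then obtain p where p: "n = Suc p" by (cases n) auto
    show ?thesis
    proof (induction a)
      case 0
      then show ?case using False by (simp add: PF_zero_start)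
    next
      case (Suc a)
      \<comment> \<open>\<open>?M\<close> is the common base of the powers in all terms of the recurrence; it belongs to \<open>a\<close>,
        while the base in the claim for \<open>Suc a\<close> is \<open>?M + 1\<close>.\<close>
      let ?M = "a + n * b"
      have smaller: "?M * card (PF (a + j * b) b (n - j)) = (a + j * b) * ?M ^ (n - j)"
        if "j \<le> n" for j
      proof (cases "j = 0")
        case True
        then show ?thesis using Suc.IH by simp
      next
        case False
        have M: "?M = a + j * b + (n - j) * b"
          using that by (simp add: add_mult_distrib[symmetric])
        have "n - j < n" using False \<open>n \<noteq> 0\<close> by simp
        then show ?thesis unfolding M by (rule less.IH)
      qed
      have "?M * card (PF (Suc a) b n)
          = (\<Sum>j\<le>n. (n choose j) * (?M * card (PF (a + j * b) b (n - j))))"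
        unfolding card_PF_Suc sum_distrib_left by (intro sum.cong refl mult.left_commute)
      also have "\<dots> = (\<Sum>j\<le>n. (n choose j) * ((a + j * b) * ?M ^ (n - j)))"
        by (intro sum.cong refl) (simp only: smaller atMost_iff)
      also have "\<dots> = a * (\<Sum>j\<le>n. (n choose j) * ?M ^ (n - j))
          + b * (\<Sum>j\<le>n. j * (n choose j) * ?M ^ (n - j))"
        by (simp add: sum_distrib_left sum.distrib algebra_simps)
      also have "\<dots> = a * (?M + 1) ^ n + b * (n * (?M + 1) ^ (n - 1))"
        by (simp only: sum_binomial_pow sum_index_binomial_pow)
      also have "\<dots> = ?M * (Suc a * (?M + 1) ^ (n - 1))"
        by (simp add: p algebra_simps)
      finally have "card (PF (Suc a) b n) = Suc a * (?M + 1) ^ (n - 1)"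
        using assms False by simp
      then show ?case by (simp add: p algebra_simps)
    qed
  qed (simp add: PF_0)
qed

lemma card_PF:
  assumes "0 < a" "0 < b"
  shows "real (card (PF a b n)) = real a * real (a + n * b) powi (int n - 1)"
proof -
  have pos: "real (a + n * b) > 0" using assms by (simp add: add_pos_nonneg)
  have "real (a + n * b) * real (card (PF a b n)) = real a * real (a + n * b) ^ n"
    using card_PF_mult[OF assms(2), of a n] by (metis of_nat_mult of_nat_power)
  then show ?thesis
    using pos by (simp add: power_int_diff field_simps)
qed

section \<open>Removing the prescribed entries\<close>

text \<open>
  Parking functions for the bounds \<open>a + i b\<close> when \<open>i < k\<close> and \<open>a + (i + l) b\<close> when \<open>i \<ge> k\<close>: an
  arithmetic progression in which the \<open>l\<close> terms from \<open>a + k b\<close> on have been left out.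
\<close>

definition gap_PF :: "nat \<Rightarrow> nat \<Rightarrow> nat \<Rightarrow> nat \<Rightarrow> nat \<Rightarrow> nat list set" where
  "gap_PF a b l k n =
     {xs. length xs = n \<and> (\<forall>x\<in>set xs. 0 < x) \<and> (\<forall>i<k. i < num_le xs (a + i * b)) \<and>
          (\<forall>i. k \<le> i \<and> i < n \<longrightarrow> i < num_le xs (a + (i + l) * b))}"

lemma num_le_progression:
  assumes "0 < b"
  shows "num_le (map (\<lambda>j. a + (k + j) * b) [0..<l]) (a + i * b) = min l (Suc i - k)"
proof -
  have "num_le (map (\<lambda>j. a + (k + j) * b) [0..<l]) (a + i * b)
      = card {j. j < l \<and> k + j \<le> i}"
    using assms
    by (auto simp: num_le_def filter_map o_def length_filter_conv_card intro!: arg_cong[where f = card])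
  also have "{j. j < l \<and> k + j \<le> i} = {..<min l (Suc i - k)}"
    by auto
  finally show ?thesis by simp
qed

text \<open>
  The progression has \<open>min l (i + 1 - k)\<close> terms up to \<open>a + i b\<close>, so at least \<open>i + 1\<close> minus this
  number have to come from \<open>xs\<close>. For \<open>i < k\<close> this is \<open>i + 1\<close>. For \<open>k \<le> i < k + l\<close> it is \<open>k\<close>, which
  the bound at \<open>k - 1\<close> already guarantees. For \<open>i \<ge> k + l\<close> it is \<open>i + 1 - l\<close>, which is the bound at
  \<open>i - l\<close> after the gap.
\<close>

lemma append_progression_PF_iff:
  assumes "0 < a" "0 < b" "k \<le> n"
  shows "map (\<lambda>j. a + (k + j) * b) [0..<l] @ xs \<in> PF a b (l + n) \<longleftrightarrow> xs \<in> gap_PF a b l k n"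
proof -
  let ?c = "\<lambda>i. num_le xs (a + i * b)"
  have mono: "?c i \<le> ?c j" if "i \<le> j" for i j
    using that by (intro num_le_mono) simp
  have "(\<forall>i<l + n. i < min l (Suc i - k) + ?c i) \<longleftrightarrow>
        (\<forall>i<k. i < ?c i) \<and> (\<forall>i. k \<le> i \<and> i < n \<longrightarrow> i < ?c (i + l))" (is "?L \<longleftrightarrow> ?R")
  proof (intro iffI conjI allI impI)
    fix i assume ?L "i < k"
    then show "i < ?c i" using assms(3) by (auto dest: spec[of _ i])
  next
    fix i assume ?L "k \<le> i \<and> i < n"
    then show "i < ?c (i + l)" by (auto dest!: spec[of _ "i + l"])
  next
    fix i assume R: ?R and i: "i < l + n"
    consider "i < k" | "k \<le> i" "i < k + l" | "k + l \<le> i" by linarith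
    then show "i < min l (Suc i - k) + ?c i"
    proof cases
      case 1
      then show ?thesis using R by (simp add: trans_less_add2)
    next
      case 2
      have "k \<le> ?c i"
      proof (cases k)
        case (Suc p)
        then have "p < ?c p" using R by simp
        also have "\<dots> \<le> ?c i" using 2 Suc by (intro mono) simp
        finally show ?thesis using Suc by simp
      qed simp
      then show ?thesis using 2 by simp
    next
      case 3
      then have "k \<le> i - l \<and> i - l < n" using i by auto
      then have "i - l < ?c (i - l + l)" using R by blast
      then show ?thesis using 3 by simp
    qed
  qed
  then show ?thesis
    using assms by (auto simp: PF_iff gap_PF_def num_le_append num_le_progression)
qed

lemma card_PF_progression_prefix:
  assumes "0 < a" "0 < b" "l \<le> m" "k \<le> m - l"
  shows "card {\<pi> \<in> PF a b m. \<forall>j\<in>{1..l}. \<pi> ! (j - 1) = a + (k + j - 1) * b}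
    = card (gap_PF a b l k (m - l))"
proof -
  let ?p = "map (\<lambda>j. a + (k + j) * b) [0..<l]"
  have m: "m = l + (m - l)" using assms by simp
  have prefix: "(\<forall>j\<in>{1..l}. \<pi> ! (j - 1) = a + (k + j - 1) * b) \<longleftrightarrow> take l \<pi> = ?p"
    if "length \<pi> = m" for \<pi>
  proof
    assume *: "\<forall>j\<in>{1..l}. \<pi> ! (j - 1) = a + (k + j - 1) * b"
    have "\<pi> ! i = a + (k + i) * b" if "i < l" for i
      using *[rule_format, of "Suc i"] that by simp
    then show "take l \<pi> = ?p"
      using that assms(3) by (intro nth_equalityI) auto
  next
    assume *: "take l \<pi> = ?p"
    show "\<forall>j\<in>{1..l}. \<pi> ! (j - 1) = a + (k + j - 1) * b"
    proof
      fix j assume j: "j \<in> {1..l}"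
      then have pred: "k + (j - 1) = k + j - 1" "j - 1 < l" by auto
      have "\<pi> ! (j - 1) = take l \<pi> ! (j - 1)"
        using pred(2) by (rule nth_take[symmetric])
      then show "\<pi> ! (j - 1) = a + (k + j - 1) * b"
        using pred unfolding * by (simp del: One_nat_def)
    qed
  qed
  have "{\<pi> \<in> PF a b m. \<forall>j\<in>{1..l}. \<pi> ! (j - 1) = a + (k + j - 1) * b}
      = (\<lambda>xs. ?p @ xs) ` gap_PF a b l k (m - l)" (is "?S = ?I")
  proof (intro equalityI subsetI)
    fix \<pi> assume \<pi>: "\<pi> \<in> ?S"
    then have "take l \<pi> = ?p" using prefix PF_length_pos by blast
    then have eq: "\<pi> = ?p @ drop l \<pi>" by (metis append_take_drop_id)
    then have "?p @ drop l \<pi> \<in> PF a b (l + (m - l))" using \<pi> m by simp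
    then show "\<pi> \<in> ?I" using eq append_progression_PF_iff[OF assms(1,2,4)] by blast
  next
    fix \<pi> assume "\<pi> \<in> ?I"
    then obtain xs where xs: "\<pi> = ?p @ xs" "xs \<in> gap_PF a b l k (m - l)" by blast
    then have "?p @ xs \<in> PF a b (l + (m - l))"
      using append_progression_PF_iff[OF assms(1,2,4)] by blast
    then have "\<pi> \<in> PF a b m" using m xs(1) by simp
    moreover have "take l \<pi> = ?p" by (simp add: xs(1))
    ultimately show "\<pi> \<in> ?S" using prefix PF_length_pos by blast
  qed
  then show ?thesis
    by (simp add: card_image inj_on_def)
qed

section \<open>Splitting at the first violated bound\<close>

text \<open>
  When exactly \<open>t\<close> entries are at most \<open>a + t b\<close>, the bound \<open>a + (t + i + l) b\<close> at index \<open>t + i\<close>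
  turns into the bound \<open>l b + i b\<close> at index \<open>i\<close> for the high part. At an index between \<open>k\<close> and \<open>t\<close> the
  bound of \<open>gap_PF\<close> is weaker than the bound \<open>a + i b\<close>, which the low part meets.
\<close>

lemma gap_PF_split:
  assumes "k \<le> t" "t \<le> n"
  shows "low (a + t * b) xs \<in> PF a b t \<and> high (a + t * b) xs \<in> PF (l * b) b (n - t) \<longleftrightarrow>
    xs \<in> gap_PF a b l k n \<and> (\<forall>i<t. i < num_le xs (a + i * b)) \<and> num_le xs (a + t * b) = t"
proof -
  let ?c = "\<lambda>i. num_le xs (a + i * b)" and ?h = "high (a + t * b) xs"
  have mono: "?c i \<le> ?c j" if "i \<le> j" for i j
    using that by (intro num_le_mono) simp
  have low: "low (a + t * b) xs \<in> PF a b t \<longleftrightarrow>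
      ?c t = t \<and> (\<forall>x\<in>set xs. 0 < x) \<and> (\<forall>i<t. i < ?c i)"
    using positive_low_high(1)[of "a + t * b" xs]
    by (auto simp: PF_iff length_low num_le_low)
  have "length ?h = n - t \<longleftrightarrow> length xs = n" if "?c t = t"
    using length_low_high[of "a + t * b" xs] that assms by (auto simp: length_low)
  moreover have "(\<forall>i<n - t. i < num_le ?h (l * b + i * b)) \<longleftrightarrow>
      (\<forall>i. t \<le> i \<and> i < n \<longrightarrow> i < ?c (i + l))" if t: "?c t = t"
  proof -
    have shift: "t + num_le ?h (l * b + i * b) = ?c (t + i + l)" for i
      using num_le_high[of xs "a + t * b" "l * b + i * b"] t by (simp add: algebra_simps)
    show ?thesis
    proof (intro iffI allI impI)
      fix i assume "\<forall>i<n - t. i < num_le ?h (l * b + i * b)" "t \<le> i \<and> i < n"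
      then show "i < ?c (i + l)" using shift[of "i - t"] by (auto dest!: spec[of _ "i - t"])
    next
      fix i assume "\<forall>i. t \<le> i \<and> i < n \<longrightarrow> i < ?c (i + l)" "i < n - t"
      then show "i < num_le ?h (l * b + i * b)"
        using shift[of i] by (auto dest!: spec[of _ "t + i"])
    qed
  qed
  ultimately have high: "?h \<in> PF (l * b) b (n - t) \<longleftrightarrow>
      length xs = n \<and> (\<forall>i. t \<le> i \<and> i < n \<longrightarrow> i < ?c (i + l))" if "?c t = t"
    using that positive_low_high(2)[of "a + t * b" xs] by (auto simp: PF_iff)
  have "(\<forall>i. k \<le> i \<and> i < n \<longrightarrow> i < ?c (i + l))"
    if "\<forall>i<t. i < ?c i" "\<forall>i. t \<le> i \<and> i < n \<longrightarrow> i < ?c (i + l)"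
    using that mono by (metis le_add1 linorder_not_le order_less_le_trans)
  then show ?thesis
    using low high assms by (auto simp: gap_PF_def)
qed

text \<open>
  The first index \<open>t\<close> at which at most \<open>t\<close> entries are \<open>\<le> a + t b\<close> exists, since \<open>n\<close> is such an index.
  It is at least \<open>k\<close>, because the bounds before \<open>k\<close> are those of \<open>PF a b\<close>, and by minimality more
  than \<open>t - 1\<close> entries are already \<open>\<le> a + (t - 1) b\<close>, which forces equality at \<open>t\<close>.
\<close>

lemma gap_PF_break:
  assumes "xs \<in> gap_PF a b l k n"
  shows "\<exists>t. k \<le> t \<and> t \<le> n \<and> (\<forall>i<t. i < num_le xs (a + i * b)) \<and> num_le xs (a + t * b) = t"
proof -
  let ?c = "\<lambda>i. num_le xs (a + i * b)"
  define t where "t = (LEAST t. ?c t \<le> t)"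
  have n: "?c n \<le> n"
    using assms num_le_le_length[of xs] by (auto simp: gap_PF_def)
  have t: "?c t \<le> t" unfolding t_def by (rule LeastI[where P = "\<lambda>t. ?c t \<le> t", OF n])
  have below: "i < ?c i" if "i < t" for i
    using not_less_Least[of i "\<lambda>t. ?c t \<le> t"] that unfolding t_def by simp
  have "t \<le> ?c t"
  proof (cases t)
    case (Suc p)
    then have "p < ?c p" using below by simp
    also have "\<dots> \<le> ?c t" using Suc by (intro num_le_mono) simp
    finally show ?thesis using Suc by simp
  qed simp
  moreover have "k \<le> t"
  proof (rule ccontr)
    assume "\<not> k \<le> t"
    then have "t < ?c t" using assms by (simp add: gap_PF_def)
    then show False using t by simp
  qed
  moreover have "t \<le> n" unfolding t_def by (rule Least_le[where P = "\<lambda>t. ?c t \<le> t", OF n])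
  ultimately show ?thesis using t below by (intro exI[of _ t]) auto
qed

lemma card_gap_PF:
  assumes "k \<le> n"
  shows "card (gap_PF a b l k n) =
    (\<Sum>s = 0..n - k. (n choose s) * card (PF a b (n - s)) * card (PF (l * b) b s))"
proof -
  define F where "F s = {xs. low (a + (n - s) * b) xs \<in> PF a b (n - s) \<and>
      high (a + (n - s) * b) xs \<in> PF (l * b) b s}" for s
  have F: "F s = {xs \<in> gap_PF a b l k n. (\<forall>i<n - s. i < num_le xs (a + i * b)) \<and>
      num_le xs (a + (n - s) * b) = n - s}" if "s \<le> n - k" for s
    using gap_PF_split[of k "n - s" n a b _ l] that assms by (auto simp: F_def)
  have cardF: "finite (F s)"
    "card (F s) = (n choose s) * card (PF a b (n - s)) * card (PF (l * b) b s)"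
    if "s \<le> n - k" for s
  proof -
    show "finite (F s)"
      unfolding F_def
      by (rule card_low_high(1)[where t = "n - s" and s = s])
         (auto simp: finite_PF PF_length_pos PF_le)
    have "card (F s) = ((n - s + s) choose s) * card (PF a b (n - s)) * card (PF (l * b) b s)"
      unfolding F_def by (rule card_low_high(2)) (auto simp: finite_PF PF_length_pos PF_le)
    then show "card (F s) = (n choose s) * card (PF a b (n - s)) * card (PF (l * b) b s)"
      using that by simp
  qed
  \<comment> \<open>A list in two parts would have exactly \<open>t\<close> entries \<open>\<le> a + t b\<close> for the smaller index \<open>t\<close>,
    but more than \<open>t\<close> because of the larger one.\<close>
  have less: "F s \<inter> F s' = {}" if "s \<le> n - k" "s' \<le> n - k" "s < s'" for s s'
  proof -
    have "n - s' < n - s" using that assms by simp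
    then show ?thesis unfolding F[OF that(1)] F[OF that(2)] by auto
  qed
  have disj: "F s \<inter> F s' = {}" if "s \<le> n - k" "s' \<le> n - k" "s \<noteq> s'" for s s'
    using less[of s s'] less[of s' s] that by (cases "s < s'") (simp_all add: Int_commute)
  have "gap_PF a b l k n = (\<Union>s\<in>{0..n - k}. F s)"
  proof (intro equalityI subsetI)
    fix xs assume xs: "xs \<in> gap_PF a b l k n"
    then obtain t where t: "k \<le> t" "t \<le> n" "\<forall>i<t. i < num_le xs (a + i * b)"
        "num_le xs (a + t * b) = t"
      using gap_PF_break by blast
    then have "xs \<in> F (n - t)"
      using xs by (subst F) auto
    then show "xs \<in> (\<Union>s\<in>{0..n - k}. F s)" using t by auto
  qed (use F in auto)
  also have "card \<dots> = (\<Sum>s = 0..n - k. card (F s))"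
    using cardF(1) disj by (intro card_UN_disjoint) simp_all
  finally show ?thesis using cardF(2) by simp
qed

theorem proposition3p1:
  fixes a b m l k :: nat
  assumes "0 < a" and "0 < b" and "0 < m"
    and "1 \<le> l" and "l \<le> m" and "k \<le> m - l"
  shows "real (card {\<pi> \<in> PF a b m. \<forall>j\<in>{1..l}. \<pi> ! (j - 1) = a + (k + j - 1) * b}) =
    real a * (\<Sum>s = 0..m - l - k.
      real ((m - l) choose s)
      * real (a + (m - l - s) * b) powi (int m - int s - int l - 1)
      * real b ^ s
      * real l * real (s + l) powi (int s - 1))"
proof -
  have low: "real (card (PF a b (m - l - s)))
      = real a * real (a + (m - l - s) * b) powi (int m - int s - int l - 1)"
    if "s \<le> m - l - k" for s
  proof -
    have "int (m - l - s) - 1 = int m - int s - int l - 1" using that assms by linarith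
    then show ?thesis using card_PF[OF assms(1,2), of "m - l - s"] by (simp only:)
  qed
  have high: "real (card (PF (l * b) b s)) = real b ^ s * (real l * real (s + l) powi (int s - 1))" for s
  proof -
    have "real (card (PF (l * b) b s)) = real (l * b) * real (b * (s + l)) powi (int s - 1)"
      using card_PF[of "l * b" b s] assms by (simp add: algebra_simps)
    also have "\<dots> = real b ^ s * (real l * real (s + l) powi (int s - 1))"
      using assms by (simp add: power_int_mult_distrib power_int_diff)
    finally show ?thesis .
  qed
  have "real (card {\<pi> \<in> PF a b m. \<forall>j\<in>{1..l}. \<pi> ! (j - 1) = a + (k + j - 1) * b}) =
      (\<Sum>s = 0..m - l - k. real ((m - l) choose s) * real (card (PF a b (m - l - s)))
        * real (card (PF (l * b) b s)))"
    unfolding card_PF_progression_prefix[OF assms(1,2,5,6)] card_gap_PF[OF assms(6)]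
    by (simp only: of_nat_sum of_nat_mult)
  also have "\<dots> = (\<Sum>s = 0..m - l - k. real a * (real ((m - l) choose s)
      * real (a + (m - l - s) * b) powi (int m - int s - int l - 1)
      * real b ^ s * real l * real (s + l) powi (int s - 1)))"
  proof (rule sum.cong[OF refl])
    fix s assume "s \<in> {0..m - l - k}"
    then have "s \<le> m - l - k" by simp
    show "real ((m - l) choose s) * real (card (PF a b (m - l - s))) * real (card (PF (l * b) b s))
      = real a * (real ((m - l) choose s)
      * real (a + (m - l - s) * b) powi (int m - int s - int l - 1)
      * real b ^ s * real l * real (s + l) powi (int s - 1))"
      unfolding low[OF \<open>s \<le> m - l - k\<close>] high by (simp only: mult_ac)
  qed
  finally show ?thesis
    unfolding sum_distrib_left .
qed

end
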